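(* Let $k$ be a field and let $V$ and $W$ be finite-dimensional vector spaces over $k$. There is a bijection between the set of triples $$\{(f,g,v) : f\in \mathrm{Hom}_k(V,W),\ g\in \mathrm{Hom}_k(W,V),\ v\in V,\ gf \text{ is nilpotent},\ v \text{ is balanced for } (f,g)\}$$ and the set $\mathrm{Hom}_k(V,W)\times \mathrm{Hom}_k(W,V)$.
   Context: Let $f:V\to W$ and $g:W\to V$ be linear maps and put $T=gf\in\mathrm{End}(V)$, $T'=fg\in\mathrm{End}(W)$. The pair $(f,g)$ is a nilpotent pair if $T$ is nilpotent (equivalently, $T'$ is nilpotent). For a nilpotent pair and $v\in V$, let $T[v]\subseteq V$ be the span of $v,Tv,T^2v,\dots$ and $T'[fv]\subseteq W$ the span of $fv,T'(fv),(T')^2(fv),\dots$. If $a$ is the least integer with $T^a v=0$ and $\ell$ is the least integer with $(T')^\ell(fv)=0$, then $\dim T[v]=a$ and $\dim T'[fv]=\ell$. The vector $v$ is balanced if $a=\ell$, i.e. $\dim T[v]=\dim T'[fv]$. In particular, $v=0$ is balanced. *)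

theory Defs
  imports Complex_Main
begin

definition nilpotent_map :: "('v::zero \<Rightarrow> 'v) \<Rightarrow> bool" where
  "nilpotent_map T \<longleftrightarrow> (\<exists>n. \<forall>x. (T ^^ n) x = 0)"

text \<open>The least \<open>n\<close> with \<open>T\<^sup>n v = 0\<close>; only meaningful if there is such an \<open>n\<close>.\<close>

definition nil_height :: "('v::zero \<Rightarrow> 'v) \<Rightarrow> 'v \<Rightarrow> nat" where
  "nil_height T v = (LEAST n. (T ^^ n) v = 0)"

definition balanced :: "('v::zero \<Rightarrow> 'w::zero) \<Rightarrow> ('w \<Rightarrow> 'v) \<Rightarrow> 'v \<Rightarrow> bool" where
  "balanced f g v \<longleftrightarrow> nil_height (g \<circ> f) v = nil_height (f \<circ> g) (f v)"

text \<open>The subspace \<open>T[v]\<close>; it occurs only in \<open>balanced_iff_dim\<close> below, which gives the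
  description of balanced vectors by dimensions.\<close>

definition cyclic_subspace :: "('k::field \<Rightarrow> 'v \<Rightarrow> 'v::ab_group_add) \<Rightarrow> ('v \<Rightarrow> 'v) \<Rightarrow> 'v \<Rightarrow> 'v set" where
  "cyclic_subspace s T v = module.span s (range (\<lambda>n. (T ^^ n) v))"

lemma (in vector_space) cyclic_basis:
  assumes T: "Vector_Spaces.linear scale scale T"
    and "(T ^^ a) v = 0" "\<And>i. i < a \<Longrightarrow> (T ^^ i) v \<noteq> 0"
  shows "independent ((\<lambda>i. (T ^^ i) v) ` {..<a}) \<and> card ((\<lambda>i. (T ^^ i) v) ` {..<a}) = a"
  using assms(2,3)
proof (induction a arbitrary: v)
  case 0
  then show ?case by (simp add: independent_empty)
next
  case (Suc a)
  interpret T: Vector_Spaces.linear scale scale T by (rule T)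
  have zero: "(T ^^ i) 0 = 0" for i
    by (induction i) (auto simp: T.zero)
  have shift: "(T ^^ i) (T v) = (T ^^ Suc i) v" for i
    by (simp only: funpow_Suc_right o_apply)
  let ?B = "(\<lambda>i. (T ^^ i) (T v)) ` {..<a}"
  have B: "independent ?B \<and> card ?B = a"
  proof (rule Suc.IH)
    show "(T ^^ a) (T v) = 0"
      using Suc.prems(1) by (simp only: shift)
    show "(T ^^ i) (T v) \<noteq> 0" if "i < a" for i
      unfolding shift using Suc.prems(2) that by blast
  qed
  have sub: "subspace {x. (T ^^ a) x = 0}"
  proof -
    have "(T ^^ i) (x + y) = (T ^^ i) x + (T ^^ i) y" for i x y
      by (induction i) (auto simp: T.add)
    moreover have "(T ^^ i) (c *s x) = c *s (T ^^ i) x" for i c x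
      by (induction i) (auto simp: T.scale)
    ultimately show ?thesis
      by (auto simp: subspace_def zero)
  qed
  have "(T ^^ a) ((T ^^ i) (T v)) = 0" for i
  proof -
    have "(T ^^ a) ((T ^^ i) (T v)) = (T ^^ (a + Suc i)) v"
      by (simp only: shift funpow_add o_apply)
    also have "a + Suc i = i + Suc a" by simp
    also have "(T ^^ (i + Suc a)) v = (T ^^ i) ((T ^^ Suc a) v)"
      by (simp only: funpow_add o_apply)
    finally show ?thesis by (simp only: Suc.prems(1) zero)
  qed
  then have "?B \<subseteq> {x. (T ^^ a) x = 0}" by auto
  then have "span ?B \<subseteq> {x. (T ^^ a) x = 0}"
    using sub by (rule span_minimal)
  then have v: "v \<notin> span ?B"
    using Suc.prems(2)[of a] by auto
  have eq: "(\<lambda>i. (T ^^ i) v) ` {..<Suc a} = insert v ?B"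
    by (simp only: lessThan_Suc_eq_insert_0 image_insert image_image shift funpow_0)
  have "v \<notin> ?B"
    using v by (rule contrapos_nn) (rule span_base)
  then have "card (insert v ?B) = Suc a"
    using B by (simp only: card_insert_disjoint finite_imageI finite_lessThan not_False_eq_True)
  then show ?case
    unfolding eq using B v independent_insertI by metis
qed

lemma dim_cyclic_subspace:
  assumes T: "Vector_Spaces.linear s s T" and n: "(T ^^ n) v = 0"
  shows "vector_space.dim s (cyclic_subspace s T v) = nil_height T v"
proof -
  interpret T: Vector_Spaces.linear s s T by (rule T)
  let ?a = "nil_height T v"
  let ?B = "(\<lambda>i. (T ^^ i) v) ` {..<?a}"
  have a: "(T ^^ ?a) v = 0"
    unfolding nil_height_def using n by (rule LeastI)
  have least: "(T ^^ i) v \<noteq> 0" if "i < ?a" for i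
    using that not_less_Least unfolding nil_height_def by blast
  have B: "\<not> T.vs1.dependent ?B \<and> card ?B = ?a"
    using T.vs1.cyclic_basis[OF T a least] .
  have "(T ^^ i) v \<in> insert 0 ?B" for i
  proof (cases "i < ?a")
    case False
    have zero: "(T ^^ i) 0 = 0" for i
      by (induction i) (auto simp: T.zero)
    have "(T ^^ i) v = (T ^^ (i - ?a)) ((T ^^ ?a) v)"
      using funpow_add[of "i - ?a" ?a T] False by simp
    then show ?thesis by (simp add: a zero)
  qed auto
  moreover have "insert 0 ?B \<subseteq> T.vs1.span ?B"
    by (simp only: insert_subset T.vs1.span_zero T.vs1.span_superset simp_thms)
  ultimately have "range (\<lambda>i. (T ^^ i) v) \<subseteq> T.vs1.span ?B"
    by (meson image_subsetI subsetD)
  then have "cyclic_subspace s T v = T.vs1.span ?B"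
    unfolding cyclic_subspace_def
    by (intro subset_antisym T.vs1.span_mono T.vs1.span_minimal T.vs1.subspace_span image_mono
        subset_UNIV)
  with B show ?thesis
    using T.vs1.dim_span_eq_card_independent by metis
qed

lemma balanced_iff_dim:
  assumes f: "Vector_Spaces.linear sV sW f" and g: "Vector_Spaces.linear sW sV g"
    and nil: "nilpotent_map (g \<circ> f)"
  shows "balanced f g v \<longleftrightarrow>
    vector_space.dim sV (cyclic_subspace sV (g \<circ> f) v) =
    vector_space.dim sW (cyclic_subspace sW (f \<circ> g) (f v))"
proof -
  interpret f: Vector_Spaces.linear sV sW f by (rule f)
  interpret g: Vector_Spaces.linear sW sV g by (rule g)
  obtain n where n: "((g \<circ> f) ^^ n) v = 0"
    using nil by (auto simp: nilpotent_map_def)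
  have "((f \<circ> g) ^^ i) (f v) = f (((g \<circ> f) ^^ i) v)" for i
    by (induction i) simp_all
  then have n': "((f \<circ> g) ^^ n) (f v) = 0"
    by (simp add: n f.zero)
  show ?thesis
    unfolding balanced_def
    by (simp only: dim_cyclic_subspace[OF Vector_Spaces.linear_compose[OF f g] n]
        dim_cyclic_subspace[OF Vector_Spaces.linear_compose[OF g f] n'])
qed

end

theory Submission
  imports Defs
begin

text \<open>
  Put \<open>T = g \<circ> f\<close> and let \<open>v\<close> be balanced with height \<open>r\<close>.  The vectors \<open>x i = T\<^sup>i v\<close> for \<open>i < r\<close> form
  a basis of a subspace \<open>A\<close> of \<open>V\<close>, and because \<open>v\<close> is balanced the vectors \<open>y i = f (T\<^sup>i v)\<close> form a
  basis, of the same length, of a subspace \<open>B\<close> of \<open>W\<close>.  On these subspaces \<open>f\<close> and \<open>g\<close> are rigid: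
  \<open>f\<close> sends \<open>x i\<close> to \<open>y i\<close>, and \<open>g\<close> sends \<open>y i\<close> to \<open>x (i + 1)\<close>.  So the triple, restricted to
  \<open>(A, B)\<close>, is the same thing as a pair of ordered bases, one of \<open>A\<close> and one of \<open>B\<close>.  After a choice of
  one reference basis \<open>a\<close> of \<open>A\<close> and \<open>b\<close> of \<open>B\<close>, such a pair of bases is the same thing as a pair of
  isomorphisms \<open>A \<rightarrow> B\<close>, \<open>a i \<mapsto> y i\<close>, and \<open>B \<rightarrow> A\<close>, \<open>b i \<mapsto> x i\<close>.

  The bijection replaces the nilpotent chain on \<open>(A, B)\<close> by these two isomorphisms and leaves \<open>f\<close> and \<open>g\<close>
  as they are on fixed complements of \<open>A\<close> and \<open>B\<close>.  The pair induced on the quotients \<open>(V/A, W/B)\<close> does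
  not change (lemma \<open>congruent_funpow\<close>), so it stays nilpotent.  Hence the new maps \<open>f'\<close> and \<open>g'\<close>
  carry \<open>A\<close> and \<open>B\<close> isomorphically onto each other, and some power of \<open>g' \<circ> f'\<close> maps \<open>V\<close> into \<open>A\<close>: the subspaces
  \<open>A\<close> and \<open>B\<close> are the invertible part of the Fitting decomposition of \<open>(f', g')\<close>.

  This is what makes the construction reversible.  Every pair \<open>(f', g')\<close> has exactly one such pair of
  subspaces (lemmas \<open>core_pair_exists\<close> and \<open>core_pair_unique\<close>), so \<open>A\<close> and \<open>B\<close>, and with them the
  reference bases and the complements, can be read off from \<open>(f', g')\<close>.  Then \<open>x i = g' (b i)\<close>,
  \<open>y i = f' (a i)\<close>, \<open>v = x 0\<close>, and the chain on \<open>(A, B)\<close> can be put back.  The argument is the same over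
  finite and infinite fields.
\<close>

section \<open>Frames and projections\<close>

text \<open>A frame is an ordered basis of its span, continued by \<open>0\<close>.  The continuation lets a nilpotent
  orbit \<open>v, T v, T\<^sup>2 v, \<dots>\<close> be a frame as it stands, so that \<open>T\<close> shifts a frame without an exception at
  its last vector, and it lets \<open>x 0\<close> be the generator even when the subspace is \<open>0\<close>.\<close>

definition (in vector_space) frame :: "nat \<Rightarrow> (nat \<Rightarrow> 'b) \<Rightarrow> bool" where
  "frame r x \<longleftrightarrow> inj_on x {..<r} \<and> independent (x ` {..<r}) \<and> (\<forall>i\<ge>r. x i = 0)"

definition (in vector_space) projection_onto :: "'b set \<Rightarrow> ('b \<Rightarrow> 'b) \<Rightarrow> bool" where
  "projection_onto A p \<longleftrightarrow> Vector_Spaces.linear scale scale p \<and> range p \<subseteq> A \<and> (\<forall>x\<in>A. p x = x)"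

context vector_space
begin

lemma span_range_eventually_zero:
  fixes x :: "nat \<Rightarrow> 'b"
  assumes "\<forall>i\<ge>r. x i = 0"
  shows "span (range x) = span (x ` {..<r})"
proof (rule antisym)
  have "x i \<in> insert 0 (x ` {..<r})" for i
    using assms by (cases "i < r") auto
  then have "range x \<subseteq> insert 0 (x ` {..<r})"
    by blast
  then have "span (range x) \<subseteq> span (insert 0 (x ` {..<r}))"
    by (rule span_mono)
  then show "span (range x) \<subseteq> span (x ` {..<r})"
    by simp
qed (intro span_mono image_mono subset_UNIV)

lemma frame_dim_span:
  assumes "frame r x"
  shows "dim (span (range x)) = r"
proof -
  have "span (range x) = span (x ` {..<r})"
    using assms by (intro span_range_eventually_zero) (simp add: frame_def)
  then show ?thesis
    using assms dim_span_eq_card_independent[of "x ` {..<r}"] by (simp add: frame_def card_image)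
qed

lemma frame_nonzero:
  assumes "frame r x" "i < r"
  shows "x i \<noteq> 0"
  using assms dependent_zero unfolding frame_def by (metis image_eqI lessThan_iff)

lemma projection_onto_exists:
  assumes "subspace A"
  obtains p where "projection_onto A p"
proof -
  interpret vector_space_pair scale scale ..
  show thesis
    using linear_exists_left_inverse_on[OF linear_id assms] that
    by (auto simp: projection_onto_def)
qed

lemma projection_kernel:
  assumes p: "projection_onto A p"
  shows "p (z - p z) = 0"
proof -
  interpret vector_space_pair scale scale ..
  have "Vector_Spaces.linear scale scale p" "p (p z) = p z"
    using p by (auto simp: projection_onto_def)
  then show ?thesis
    by (simp add: linear_diff)
qed

end

context finite_dimensional_vector_space
begin

lemma frame_exists:
  assumes "subspace A"
  obtains x where "frame (dim A) x" "span (range x) = A"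
proof -
  obtain B where B: "B \<subseteq> A" "independent B" "A \<subseteq> span B" "card B = dim A"
    by (rule basis_exists)
  have "finite B"
    using B(2) by (rule finiteI_independent)
  then obtain e where e: "bij_betw e {..<dim A} B"
    using ex_bij_betw_nat_finite[of B] B(4) by (metis atLeast0LessThan)
  define x where "x i = (if i < dim A then e i else 0)" for i
  have im: "x ` {..<dim A} = B"
    using e by (auto simp: x_def bij_betw_def)
  have "frame (dim A) x"
    unfolding frame_def im using e B(2) by (auto simp: x_def bij_betw_def inj_on_def)
  moreover have "span (range x) = A"
  proof -
    have "span (range x) = span B"
      using span_range_eventually_zero[of "dim A" x] by (simp add: im) (simp add: x_def)
    then show ?thesis
      using B(1,3) assms span_minimal by blast
  qed
  ultimately show thesis ..
qed

text \<open>A spanning family of \<open>r\<close> vectors in dimension \<open>r\<close> is a basis.  So the image of a frame under a map that is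
  onto a subspace of the same dimension is a frame, without an argument about injectivity.\<close>

lemma frame_if_dim_span:
  assumes zero: "\<forall>i\<ge>r. x i = 0" and dim: "dim (span (range x)) = r"
  shows "frame r x"
proof -
  let ?S = "x ` {..<r}"
  have "dim (span (range x)) = dim ?S"
    using span_range_eventually_zero[OF zero] by simp
  then have "r = dim ?S"
    using dim by simp
  then have "r \<le> card ?S"
    using dim_le_card[of ?S ?S] span_superset by auto
  then have card: "card ?S = r"
    using card_image_le[of "{..<r}" x] by simp
  then have "inj_on x {..<r}"
    by (simp add: eq_card_imp_inj_on)
  moreover have "independent ?S"
    using card_le_dim_spanning[of ?S ?S] span_superset card \<open>r = dim ?S\<close> by auto
  ultimately show ?thesis
    using zero by (simp add: frame_def)
qed

text \<open>The exchange has to be undone from the new maps alone, so the ordered basis and the complement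
  that it uses must depend on nothing but the subspace.\<close>

definition ref_frame :: "'b set \<Rightarrow> nat \<Rightarrow> 'b" where
  "ref_frame A = (SOME x. frame (dim A) x \<and> span (range x) = A)"

definition ref_projection :: "'b set \<Rightarrow> 'b \<Rightarrow> 'b" where
  "ref_projection A = (SOME p. projection_onto A p)"

lemma ref_frame:
  assumes "subspace A"
  shows "frame (dim A) (ref_frame A)" "span (range (ref_frame A)) = A"
proof -
  have "\<exists>x. frame (dim A) x \<and> span (range x) = A"
    using frame_exists[OF assms] by blast
  from someI_ex[OF this] show "frame (dim A) (ref_frame A)" "span (range (ref_frame A)) = A"
    unfolding ref_frame_def by blast+
qed

lemma ref_projection:
  assumes "subspace A"
  shows "projection_onto A (ref_projection A)"
  unfolding ref_projection_def using projection_onto_exists[OF assms] by (metis someI)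

end

section \<open>Redirecting a linear map on a subspace\<close>

text \<open>Here \<open>p\<close> is a projection onto the span of \<open>a\<close>, and \<open>f'\<close> is the map \<open>f\<close> with its values on that span
  replaced.  The kernel of \<open>p\<close> is the complement on which nothing changes.  Frame and projection are
  separate arguments because the step and its inverse prescribe values on different frames of one
  subspace, but keep the same complement.\<close>

definition redirects ::
    "(nat \<Rightarrow> 'v) \<Rightarrow> ('v \<Rightarrow> 'v::zero) \<Rightarrow> (nat \<Rightarrow> 'w) \<Rightarrow> ('v \<Rightarrow> 'w) \<Rightarrow> ('v \<Rightarrow> 'w) \<Rightarrow> bool" where
  "redirects a p y f f' \<longleftrightarrow> (\<forall>i. f' (a i) = y i) \<and> (\<forall>z. p z = 0 \<longrightarrow> f' z = f z)"

context vector_space_pair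
begin

lemma frame_linear_extend:
  assumes x: "vs1.frame r x" and y: "\<forall>i\<ge>r. y i = 0"
  obtains F where "Vector_Spaces.linear s1 s2 F" "\<And>i. F (x i) = y i"
proof -
  obtain F where F: "Vector_Spaces.linear s1 s2 F"
    and eq: "\<forall>u\<in>x ` {..<r}. F u = y (inv_into {..<r} x u)"
    using linear_independent_extend[of "x ` {..<r}" "\<lambda>u. y (inv_into {..<r} x u)"] x
    unfolding vs1.frame_def by blast
  have "F (x i) = y i" for i
  proof (cases "i < r")
    case True
    then show ?thesis
      using eq x by (simp add: vs1.frame_def)
  next
    case False
    then show ?thesis
      using x y linear_0[OF F] by (simp add: vs1.frame_def)
  qed
  with F that show thesis by blast
qed

lemma redirects_exists:
  assumes x: "vs1.frame r x" and y: "\<forall>i\<ge>r. y i = 0"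
    and p: "vs1.projection_onto (vs1.span (range x)) p"
    and f: "Vector_Spaces.linear s1 s2 f"
  obtains f' where "Vector_Spaces.linear s1 s2 f'" "redirects x p y f f'"
proof -
  obtain F where F: "Vector_Spaces.linear s1 s2 F" "\<And>i. F (x i) = y i"
    by (rule frame_linear_extend[OF x y]) blast
  have lp: "Vector_Spaces.linear s1 s1 p"
    using p by (simp add: vs1.projection_onto_def)
  have px: "p (x i) = x i" for i
    using p vs1.span_base[of "x i" "range x"] by (simp add: vs1.projection_onto_def)
  \<comment> \<open>This is \<open>F \<circ> p + f \<circ> (id - p)\<close>.\<close>
  let ?f' = "\<lambda>z. f z + (F (p z) - f (p z))"
  have "Vector_Spaces.linear s1 s2 (\<lambda>z. F (p z))" "Vector_Spaces.linear s1 s2 (\<lambda>z. f (p z))"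
    using Vector_Spaces.linear_compose[OF lp F(1)] Vector_Spaces.linear_compose[OF lp f]
    by (simp_all add: o_def)
  then have "Vector_Spaces.linear s1 s2 ?f'"
    by (intro linear_compose_add linear_compose_sub f)
  moreover have "redirects x p y f ?f'"
    using F linear_0[OF f] linear_0[OF F(1)] by (simp add: redirects_def px)
  ultimately show thesis ..
qed

lemma linear_eq_if_agree:
  assumes f: "Vector_Spaces.linear s1 s2 f" and f': "Vector_Spaces.linear s1 s2 f'"
    and p: "vs1.projection_onto (vs1.span (range x)) p"
    and frame: "\<And>i. f (x i) = f' (x i)" and kernel: "\<And>z. p z = 0 \<Longrightarrow> f z = f' z"
  shows "f = f'"
proof
  fix z
  have "p z \<in> vs1.span (range x)"
    using p by (auto simp: vs1.projection_onto_def)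
  then have "f (p z) = f' (p z)"
    by (rule linear_eq_on[OF f f']) (use frame in auto)
  moreover have "f (z - p z) = f' (z - p z)"
    by (rule kernel) (rule vs1.projection_kernel[OF p])
  ultimately show "f z = f' z"
    using linear_diff[OF f] linear_diff[OF f'] by simp
qed

text \<open>Redirecting inside \<open>Hom(A, B)\<close> does not change the map modulo \<open>B\<close>: the two maps agree at
  \<open>z - p z\<close>, and both send \<open>p z\<close> into \<open>B\<close>.\<close>

lemma redirects_congruent:
  assumes f: "Vector_Spaces.linear s1 s2 f" and f': "Vector_Spaces.linear s1 s2 f'"
    and p: "vs1.projection_onto A p" and B: "vs2.subspace B"
    and fA: "f ` A \<subseteq> B" "f' ` A \<subseteq> B" and r: "redirects a p y f f'"
  shows "f z - f' z \<in> B"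
proof -
  have "p z \<in> A"
    using p by (auto simp: vs1.projection_onto_def)
  then have "f (p z) - f' (p z) \<in> B"
    using fA by (intro vs2.subspace_diff[OF B]) auto
  moreover have "f (z - p z) = f' (z - p z)"
    using r vs1.projection_kernel[OF p] by (simp add: redirects_def)
  then have "f z - f' z = f (p z) - f' (p z)"
    using linear_diff[OF f] linear_diff[OF f'] by (simp add: algebra_simps)
  ultimately show ?thesis by simp
qed

lemma image_span_range:
  assumes "Vector_Spaces.linear s1 s2 f" "\<And>i. f (x i) = y i"
  shows "f ` vs1.span (range x) = vs2.span (range y)"
  using linear_span_image[OF assms(1), of "range x"] assms(2) by (simp add: image_image)

end

section \<open>Stable images\<close>

text \<open>The stable images of \<open>g \<circ> f\<close> and \<open>f \<circ> g\<close>, described by the properties that can be checked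
  directly for the maps that the exchange produces.\<close>

definition core_pair :: "('v \<Rightarrow> 'w) \<Rightarrow> ('w \<Rightarrow> 'v) \<Rightarrow> 'v set \<Rightarrow> 'w set \<Rightarrow> bool" where
  "core_pair f g A B \<longleftrightarrow> f ` A = B \<and> g ` B = A \<and> (\<exists>n. \<forall>x. ((g \<circ> f) ^^ n) x \<in> A)"

text \<open>With \<open>T = g \<circ> f\<close>, a core \<open>C\<close> satisfies \<open>C = T\<^sup>n C\<close> for all \<open>n\<close>, and \<open>T\<^sup>n\<close> maps everything into any other
  core once \<open>n\<close> is large.  So each of two cores contains the other.\<close>

lemma core_pair_unique:
  assumes "core_pair f g A B" "core_pair f g A' B'"
  shows "A = A'" "B = B'"
proof -
  have sub: "C \<subseteq> C'" if C: "core_pair f g C D" and C': "core_pair f g C' D'" for C C' D D'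
  proof -
    obtain m where m: "\<And>x. ((g \<circ> f) ^^ m) x \<in> C'"
      using C' by (auto simp: core_pair_def)
    have "((g \<circ> f) ^^ n) ` C = C" for n
    proof (induction n)
      case (Suc n)
      have "((g \<circ> f) ^^ Suc n) ` C = g ` f ` ((g \<circ> f) ^^ n) ` C"
        by (simp only: funpow.simps image_comp o_assoc)
      also have "\<dots> = C"
        unfolding Suc using C by (simp add: core_pair_def)
      finally show ?case .
    qed simp
    from this[of m] have "C = ((g \<circ> f) ^^ m) ` C"
      by (rule sym)
    also have "\<dots> \<subseteq> C'"
      using m by (rule image_subsetI)
    finally show ?thesis .
  qed
  show "A = A'"
    by (rule antisym) (rule sub[OF assms], rule sub[OF assms(2,1)])
  then show "B = B'"
    using assms by (auto simp: core_pair_def)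
qed

lemma (in vector_space) linear_funpow:
  assumes "Vector_Spaces.linear scale scale T"
  shows "Vector_Spaces.linear scale scale (T ^^ n)"
proof (induction n)
  case 0
  then show ?case using linear_id by (simp add: id_def)
next
  case (Suc n)
  show ?case
    unfolding funpow.simps by (rule Vector_Spaces.linear_compose[OF Suc.IH assms])
qed

context finite_dimensional_vector_space_pair
begin

text \<open>The dimension of the range of \<open>T\<^sup>n\<close> does not increase with \<open>n\<close>, so where it is minimal the range is
  stable under \<open>T\<close>; this range and its image under \<open>f\<close> form the core.\<close>

lemma core_pair_exists:
  assumes f: "Vector_Spaces.linear s1 s2 f" and g: "Vector_Spaces.linear s2 s1 g"
  obtains A B where "vs1.subspace A" "vs2.subspace B" "core_pair f g A B"
proof -
  let ?T = "g \<circ> f"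
  have T: "Vector_Spaces.linear s1 s1 ?T"
    by (rule Vector_Spaces.linear_compose[OF f g])
  interpret vv: finite_dimensional_vector_space_pair s1 B1 s1 B1 ..
  define d where "d n = vs1.dim (range (?T ^^ n))" for n
  define n where "n = (ARG_MIN d n. True)"
  have "d n \<le> d (Suc n)"
    unfolding n_def by (rule arg_min_nat_le) simp
  let ?A = "range (?T ^^ n)"
  have sub: "vs1.subspace (range (?T ^^ n))" for n
    using vv.linear_subspace_image[OF vs1.linear_funpow[OF T] vs1.subspace_UNIV] .
  have "range (?T ^^ Suc n) \<subseteq> ?A"
    by (simp only: funpow_Suc_right image_comp[symmetric] image_mono subset_UNIV)
  then have "range (?T ^^ Suc n) = ?A"
    using \<open>d n \<le> d (Suc n)\<close> by (intro vs1.subspace_dim_equal sub) (simp_all add: d_def)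
  then have "g ` f ` ?A = ?A"
    by (simp add: image_comp o_assoc)
  then have "core_pair f g ?A (f ` ?A)"
    by (auto simp: core_pair_def)
  then show thesis
    using that sub linear_subspace_image[OF f sub] by blast
qed

lemma core_pair_dim_eq:
  assumes f: "Vector_Spaces.linear s1 s2 f" and g: "Vector_Spaces.linear s2 s1 g"
    and core: "core_pair f g A B"
  shows "vs2.dim B = vs1.dim A"
proof -
  interpret flip: finite_dimensional_vector_space_pair s2 B2 s1 B1 ..
  show ?thesis
    using dim_image_le[OF f, of A] flip.dim_image_le[OF g, of B] core
    by (simp add: core_pair_def)
qed

end

context vector_space_pair
begin

text \<open>Two pairs of maps that agree modulo \<open>(A, B)\<close>, one of which preserves \<open>(A, B)\<close>, induce the same
  maps on the quotients; in particular the \<open>n\<close>-th power of the induced map on \<open>V/A\<close> vanishes for both or for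
  neither.\<close>

lemma congruent_funpow:
  assumes f: "Vector_Spaces.linear s1 s2 f" and g: "Vector_Spaces.linear s2 s1 g"
    and A: "vs1.subspace A" and inv: "f ` A \<subseteq> B" "g ` B \<subseteq> A"
    and ff': "\<And>z. f z - f' z \<in> B" and gg': "\<And>z. g z - g' z \<in> A"
  shows "((g \<circ> f) ^^ n) z \<in> A \<longleftrightarrow> ((g' \<circ> f') ^^ n) z \<in> A"
proof -
  interpret flip: vector_space_pair s2 s1 ..
  have diff: "((g \<circ> f) ^^ n) z - ((g' \<circ> f') ^^ n) z \<in> A"
  proof (induction n)
    case 0
    then show ?case using vs1.subspace_0[OF A] by simp
  next
    case (Suc n)
    define u u' where "u = ((g \<circ> f) ^^ n) z" and "u' = ((g' \<circ> f') ^^ n) z"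
    have "u - u' \<in> A"
      using Suc unfolding u_def u'_def .
    then have 1: "g (f (u - u')) \<in> A"
      using inv by (simp add: image_subset_iff)
    have 2: "g (f u' - f' u') \<in> A"
      using inv ff' by (simp add: image_subset_iff)
    \<comment> \<open>The first step sees only \<open>u - u' \<in> A\<close>; the two other terms are the changes of \<open>f\<close> and of \<open>g\<close>.\<close>
    have "g (f u) - g' (f' u') =
        g (f (u - u')) + (g (f u' - f' u') + (g (f' u') - g' (f' u')))"
      by (simp add: linear_diff[OF f] flip.linear_diff[OF g])
    also have "\<dots> \<in> A"
      by (intro vs1.subspace_add[OF A] 1 2 gg')
    finally show ?case
      unfolding u_def u'_def funpow.simps o_apply .
  qed
  show ?thesis
  proof
    assume "((g \<circ> f) ^^ n) z \<in> A"
    from vs1.subspace_diff[OF A this diff] show "((g' \<circ> f') ^^ n) z \<in> A" by simp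
  next
    assume "((g' \<circ> f') ^^ n) z \<in> A"
    from vs1.subspace_add[OF A diff this] show "((g \<circ> f) ^^ n) z \<in> A" by simp
  qed
qed

end

section \<open>Balanced vectors\<close>

definition orbit :: "('v \<Rightarrow> 'w) \<Rightarrow> ('w \<Rightarrow> 'v) \<Rightarrow> 'v \<Rightarrow> nat \<Rightarrow> 'v" where
  "orbit f g v i = ((g \<circ> f) ^^ i) v"

lemma orbit_0 [simp]: "orbit f g v 0 = v"
  by (simp add: orbit_def)

lemma orbit_step: "g (f (orbit f g v i)) = orbit f g v (Suc i)"
  by (simp add: orbit_def)

lemma image_orbit: "f (orbit f g v i) = ((f \<circ> g) ^^ i) (f v)"
  by (induction i) (simp_all add: orbit_def)

lemma (in vector_space) frame_orbit_iff:
  assumes T: "Vector_Spaces.linear scale scale T"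
  shows "frame r (\<lambda>i. (T ^^ i) v) \<longleftrightarrow> (\<exists>n. (T ^^ n) v = 0) \<and> nil_height T v = r"
proof
  assume fr: "frame r (\<lambda>i. (T ^^ i) v)"
  then have "(T ^^ r) v = 0"
    by (simp add: frame_def)
  moreover have "r \<le> n" if "(T ^^ n) v = 0" for n
    using frame_nonzero[OF fr, of n] that by (metis not_le)
  ultimately show "(\<exists>n. (T ^^ n) v = 0) \<and> nil_height T v = r"
    unfolding nil_height_def by (blast intro: Least_equality)
next
  assume nil: "(\<exists>n. (T ^^ n) v = 0) \<and> nil_height T v = r"
  interpret T: Vector_Spaces.linear scale scale T by (rule T)
  have r: "(T ^^ r) v = 0"
    using nil unfolding nil_height_def by (auto intro: LeastI)
  have "(T ^^ i) v \<noteq> 0" if "i < r" for i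
    using nil that not_less_Least unfolding nil_height_def by blast
  from cyclic_basis[OF T r this]
  have basis: "independent ((\<lambda>i. (T ^^ i) v) ` {..<r})" "card ((\<lambda>i. (T ^^ i) v) ` {..<r}) = r"
    by blast+
  have "(T ^^ i) v = 0" if "i \<ge> r" for i
  proof -
    have zero: "(T ^^ j) 0 = 0" for j
      by (induction j) (simp_all add: T.zero)
    have "(T ^^ i) v = (T ^^ (i - r)) ((T ^^ r) v)"
      using funpow_add[of "i - r" r T] that by simp
    then show ?thesis by (simp add: r zero)
  qed
  then show "frame r (\<lambda>i. (T ^^ i) v)"
    using basis by (simp add: frame_def eq_card_imp_inj_on)
qed

text \<open>For a nilpotent pair, each of the two orbits is a frame of length equal to its height; being balanced
  says that the two lengths agree.\<close>

lemma (in vector_space_pair) balanced_iff_frames: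
  assumes f: "Vector_Spaces.linear s1 s2 f" and g: "Vector_Spaces.linear s2 s1 g"
    and nil: "nilpotent_map (g \<circ> f)"
  shows "balanced f g v \<longleftrightarrow>
    (\<exists>r. vs1.frame r (orbit f g v) \<and> vs2.frame r (\<lambda>i. f (orbit f g v i)))"
proof -
  obtain n where n: "orbit f g v n = 0"
    using nil by (auto simp: nilpotent_map_def orbit_def)
  then have n': "((f \<circ> g) ^^ n) (f v) = 0"
    using linear_0[OF f] by (simp add: image_orbit[symmetric])
  have "vs1.frame r (orbit f g v) \<longleftrightarrow> nil_height (g \<circ> f) v = r" for r
    using vs1.frame_orbit_iff[OF Vector_Spaces.linear_compose[OF f g], of r v] n
    by (auto simp: orbit_def[abs_def])
  moreover have "vs2.frame r (\<lambda>i. f (orbit f g v i)) \<longleftrightarrow> nil_height (f \<circ> g) (f v) = r" for r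
    using vs2.frame_orbit_iff[OF Vector_Spaces.linear_compose[OF g f], of r "f v"] n'
    by (auto simp: image_orbit)
  ultimately show ?thesis
    by (auto simp: balanced_def)
qed

section \<open>The exchange\<close>

context finite_dimensional_vector_space_pair
begin

text \<open>The bijection is given by its graph.  In this form the forward and the backward direction are
  treated alike, and each only has to produce maps that fit.\<close>

definition exchange ::
    "('b \<Rightarrow> 'c) \<Rightarrow> ('c \<Rightarrow> 'b) \<Rightarrow> 'b \<Rightarrow> ('b \<Rightarrow> 'c) \<Rightarrow> ('c \<Rightarrow> 'b) \<Rightarrow> bool" where
  "exchange f g v f' g' \<longleftrightarrow>
    (let x = orbit f g v; y = (\<lambda>i. f (x i));
         A = vs1.span (range x); B = vs2.span (range y)
     in redirects (vs1.ref_frame A) (vs1.ref_projection A) y f f' \<and>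
        redirects (vs2.ref_frame B) (vs2.ref_projection B) x g g')"

definition balanced_triple :: "('b \<Rightarrow> 'c) \<Rightarrow> ('c \<Rightarrow> 'b) \<Rightarrow> 'b \<Rightarrow> bool" where
  "balanced_triple f g v \<longleftrightarrow> Vector_Spaces.linear s1 s2 f \<and> Vector_Spaces.linear s2 s1 g \<and>
    nilpotent_map (g \<circ> f) \<and> balanced f g v"

text \<open>The subspaces of the chain can be recovered from the new pair of maps.  That \<open>f'\<close> and \<open>g'\<close> carry
  \<open>A\<close> and \<open>B\<close> onto each other is visible on the frames; that a power of \<open>g' \<circ> f'\<close> ends in \<open>A\<close> is inherited
  from the nilpotent \<open>g \<circ> f\<close>, since the two pairs agree modulo \<open>(A, B)\<close>.\<close>

lemma exchange_core_pair:
  assumes t: "balanced_triple f g v"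
    and f': "Vector_Spaces.linear s1 s2 f'" and g': "Vector_Spaces.linear s2 s1 g'"
    and ex: "exchange f g v f' g'"
  shows "core_pair f' g' (vs1.span (range (orbit f g v)))
    (vs2.span (range (\<lambda>i. f (orbit f g v i))))"
proof -
  interpret flip: finite_dimensional_vector_space_pair s2 B2 s1 B1 ..
  have f: "Vector_Spaces.linear s1 s2 f" and g: "Vector_Spaces.linear s2 s1 g"
    using t by (auto simp: balanced_triple_def)
  define x where "x = orbit f g v"
  define y where "y i = f (x i)" for i
  define A where "A = vs1.span (range x)"
  define B where "B = vs2.span (range y)"
  have sub: "vs1.subspace A" "vs2.subspace B"
    by (simp_all add: A_def B_def)
  note a = vs1.ref_frame[OF sub(1)] and p = vs1.ref_projection[OF sub(1)]
  note b = vs2.ref_frame[OF sub(2)] and q = vs2.ref_projection[OF sub(2)]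
  have rf: "redirects (vs1.ref_frame A) (vs1.ref_projection A) y f f'"
    and rg: "redirects (vs2.ref_frame B) (vs2.ref_projection B) x g g'"
    using ex by (simp_all add: exchange_def Let_def x_def y_def[abs_def] A_def B_def)
  have f'A: "f' ` A = B"
    using image_span_range[OF f', of "vs1.ref_frame A" y] rf
    by (simp add: a(2) B_def redirects_def)
  have g'B: "g' ` B = A"
    using flip.image_span_range[OF g', of "vs2.ref_frame B" x] rg
    by (simp add: b(2) A_def redirects_def)
  have fA: "f ` A = B"
    using image_span_range[OF f, of x y] by (simp add: y_def A_def B_def)
  have gB: "g ` B \<subseteq> A"
  proof -
    have "g ` B = vs1.span (range (\<lambda>i. x (Suc i)))"
      using flip.image_span_range[OF g, of y "\<lambda>i. x (Suc i)"]
      by (simp add: y_def x_def orbit_step B_def)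
    also have "\<dots> \<subseteq> A"
      unfolding A_def by (rule vs1.span_mono) blast
    finally show ?thesis .
  qed
  obtain n where n: "\<And>z. ((g \<circ> f) ^^ n) z = 0"
    using t by (auto simp: balanced_triple_def nilpotent_map_def)
  have "f z - f' z \<in> B" for z
    using redirects_congruent[OF f f' p sub(2) _ _ rf] fA f'A by blast
  moreover have "g z - g' z \<in> A" for z
    using flip.redirects_congruent[OF g g' q sub(1) _ _ rg] gB g'B by blast
  ultimately have "((g \<circ> f) ^^ n) z \<in> A \<longleftrightarrow> ((g' \<circ> f') ^^ n) z \<in> A" for z
    by (rule congruent_funpow[OF f g sub(1) eq_refl[OF fA] gB])
  then have "((g' \<circ> f') ^^ n) z \<in> A" for z
    using n vs1.subspace_0[OF sub(1)] by simp
  with f'A g'B have "core_pair f' g' A B"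
    unfolding core_pair_def by blast
  then show ?thesis
    by (simp add: x_def y_def[abs_def] A_def B_def)
qed

text \<open>Balancedness is what makes the redirected maps exist: the reference frames of the two subspaces
  have to be as long as the orbits that they are sent to.\<close>

lemma exchange_exists:
  assumes t: "balanced_triple f g v"
  obtains f' g' where "Vector_Spaces.linear s1 s2 f'" "Vector_Spaces.linear s2 s1 g'"
    "exchange f g v f' g'"
proof -
  interpret flip: finite_dimensional_vector_space_pair s2 B2 s1 B1 ..
  have f: "Vector_Spaces.linear s1 s2 f" and g: "Vector_Spaces.linear s2 s1 g"
    using t by (auto simp: balanced_triple_def)
  define x where "x = orbit f g v"
  define y where "y i = f (x i)" for i
  define A where "A = vs1.span (range x)"
  define B where "B = vs2.span (range y)"
  obtain r where r: "vs1.frame r x" "vs2.frame r y"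
    using t balanced_iff_frames[OF f g, of v]
    by (auto simp: balanced_triple_def x_def y_def[abs_def])
  have sub: "vs1.subspace A" "vs2.subspace B"
    by (simp_all add: A_def B_def)
  have dim: "vs1.dim A = r" "vs2.dim B = r"
    using vs1.frame_dim_span[OF r(1)] vs2.frame_dim_span[OF r(2)] by (simp_all add: A_def B_def)
  note a = vs1.ref_frame[OF sub(1), unfolded dim] and p = vs1.ref_projection[OF sub(1)]
  note b = vs2.ref_frame[OF sub(2), unfolded dim] and q = vs2.ref_projection[OF sub(2)]
  have zero: "\<forall>i\<ge>r. x i = 0" "\<forall>i\<ge>r. y i = 0"
    using r by (simp_all add: vs1.frame_def vs2.frame_def)
  obtain f' where f': "Vector_Spaces.linear s1 s2 f'"
      "redirects (vs1.ref_frame A) (vs1.ref_projection A) y f f'"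
    using redirects_exists[OF a(1) zero(2) _ f] p a(2) by metis
  obtain g' where g': "Vector_Spaces.linear s2 s1 g'"
      "redirects (vs2.ref_frame B) (vs2.ref_projection B) x g g'"
    using flip.redirects_exists[OF b(1) zero(1) _ g] q b(2) by metis
  have "exchange f g v f' g'"
    using f'(2) g'(2) by (simp add: exchange_def Let_def x_def y_def[abs_def] A_def B_def)
  with f'(1) g'(1) that show thesis by blast
qed

lemma exchange_functional:
  assumes f': "Vector_Spaces.linear s1 s2 f'" and g': "Vector_Spaces.linear s2 s1 g'"
    and f'': "Vector_Spaces.linear s1 s2 f''" and g'': "Vector_Spaces.linear s2 s1 g''"
    and ex: "exchange f g v f' g'" "exchange f g v f'' g''"
  shows "f' = f'' \<and> g' = g''"
proof -
  interpret flip: finite_dimensional_vector_space_pair s2 B2 s1 B1 ..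
  define A where "A = vs1.span (range (orbit f g v))"
  define B where "B = vs2.span (range (\<lambda>i. f (orbit f g v i)))"
  have sub: "vs1.subspace A" "vs2.subspace B"
    by (simp_all add: A_def B_def)
  have p: "vs1.projection_onto (vs1.span (range (vs1.ref_frame A))) (vs1.ref_projection A)"
    and q: "vs2.projection_onto (vs2.span (range (vs2.ref_frame B))) (vs2.ref_projection B)"
    by (simp_all add: vs1.ref_frame vs1.ref_projection vs2.ref_frame vs2.ref_projection sub)
  show ?thesis
    using ex linear_eq_if_agree[OF f' f'' p] flip.linear_eq_if_agree[OF g' g'' q]
    by (simp add: exchange_def Let_def redirects_def A_def B_def)
qed

text \<open>Both triples have the same subspaces, namely the core of \<open>(f', g')\<close>, and hence the same reference
  data.  The values of \<open>f'\<close> and \<open>g'\<close> on the reference frames are the two orbits, and these determine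
  \<open>v\<close> and the maps on \<open>A\<close> and \<open>B\<close>; on the complements nothing was changed.\<close>

lemma exchange_injective:
  assumes t1: "balanced_triple f1 g1 v1" and t2: "balanced_triple f2 g2 v2"
    and f': "Vector_Spaces.linear s1 s2 f'" and g': "Vector_Spaces.linear s2 s1 g'"
    and ex1: "exchange f1 g1 v1 f' g'" and ex2: "exchange f2 g2 v2 f' g'"
  shows "f1 = f2 \<and> g1 = g2 \<and> v1 = v2"
proof -
  interpret flip: finite_dimensional_vector_space_pair s2 B2 s1 B1 ..
  define x where "x = orbit f1 g1 v1"
  define y where "y i = f1 (x i)" for i
  define A where "A = vs1.span (range x)"
  define B where "B = vs2.span (range y)"
  have core: "A = vs1.span (range (orbit f2 g2 v2))"
      "B = vs2.span (range (\<lambda>i. f2 (orbit f2 g2 v2 i)))"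
    using core_pair_unique[OF exchange_core_pair[OF t1 f' g' ex1]
        exchange_core_pair[OF t2 f' g' ex2]]
    by (simp_all add: A_def B_def x_def y_def[abs_def])
  let ?a = "vs1.ref_frame A" and ?p = "vs1.ref_projection A"
  let ?b = "vs2.ref_frame B" and ?q = "vs2.ref_projection B"
  have 1: "redirects ?a ?p y f1 f'" "redirects ?b ?q x g1 g'"
    using ex1 by (simp_all add: exchange_def Let_def A_def B_def x_def y_def[abs_def])
  have 2: "redirects ?a ?p (\<lambda>i. f2 (orbit f2 g2 v2 i)) f2 f'"
      "redirects ?b ?q (orbit f2 g2 v2) g2 g'"
    using ex2 by (simp_all add: exchange_def Let_def core[symmetric])
  have x2: "orbit f2 g2 v2 = x"
    using 1(2) 2(2) by (auto simp: redirects_def)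
  have y2: "f2 (x i) = y i" for i
    using 1(1) 2(1) by (auto simp: redirects_def x2)
  have "v1 = v2"
    using fun_cong[OF x2, of 0] by (simp add: x_def)
  have lin: "Vector_Spaces.linear s1 s2 f1" "Vector_Spaces.linear s1 s2 f2"
      "Vector_Spaces.linear s2 s1 g1" "Vector_Spaces.linear s2 s1 g2"
    using t1 t2 by (auto simp: balanced_triple_def)
  have "f1 = f2"
  proof (rule linear_eq_if_agree[OF lin(1,2)])
    show "vs1.projection_onto (vs1.span (range x)) ?p"
      unfolding A_def by (rule vs1.ref_projection) simp
    show "f1 (x i) = f2 (x i)" for i
      by (simp add: y2) (simp add: y_def)
    show "f1 z = f2 z" if "?p z = 0" for z
      using that 1(1) 2(1) by (simp add: redirects_def)
  qed
  moreover have "g1 = g2"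
  proof (rule flip.linear_eq_if_agree[OF lin(3,4)])
    show "vs2.projection_onto (vs2.span (range y)) ?q"
      unfolding B_def by (rule vs2.ref_projection) simp
    show "g1 (y i) = g2 (y i)" for i
    proof -
      have "g1 (y i) = x (Suc i)"
        by (simp add: y_def x_def orbit_step)
      moreover have "g2 (y i) = orbit f2 g2 v2 (Suc i)"
        using orbit_step[of g2 f2 v2 i] by (simp add: x2 y2)
      ultimately show ?thesis by (simp add: x2)
    qed
    show "g1 z = g2 z" if "?q z = 0" for z
      using that 1(2) 2(2) by (simp add: redirects_def)
  qed
  ultimately show ?thesis
    using \<open>v1 = v2\<close> by blast
qed

text \<open>On the core \<open>(A, B)\<close> of \<open>(f', g')\<close> the images of the reference frames are again frames, because
  \<open>f'\<close> and \<open>g'\<close> are onto there.  Sending \<open>x i\<close> to \<open>y i\<close> and \<open>y i\<close> to \<open>x (i + 1)\<close> yields a balanced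
  orbit \<open>x\<close> that starts at \<open>x 0\<close>.  The new \<open>g \<circ> f\<close> is nilpotent on \<open>A\<close>, where it shifts \<open>x\<close>, and on \<open>V/A\<close>,
  where it agrees with \<open>g' \<circ> f'\<close>, hence on \<open>V\<close>.\<close>

lemma exchange_surjective:
  assumes f': "Vector_Spaces.linear s1 s2 f'" and g': "Vector_Spaces.linear s2 s1 g'"
  obtains f g v where "balanced_triple f g v" "exchange f g v f' g'"
proof -
  interpret flip: finite_dimensional_vector_space_pair s2 B2 s1 B1 ..
  interpret vv: finite_dimensional_vector_space_pair s1 B1 s1 B1 ..
  obtain A B where sub: "vs1.subspace A" "vs2.subspace B" and core: "core_pair f' g' A B"
    using core_pair_exists[OF f' g'] by blast
  then have f'A: "f' ` A = B" and g'B: "g' ` B = A"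
    by (auto simp: core_pair_def)
  define r where "r = vs1.dim A"
  have dim: "vs1.dim A = r" "vs2.dim B = r"
    using core_pair_dim_eq[OF f' g' core] by (simp_all add: r_def)
  note a = vs1.ref_frame[OF sub(1), unfolded dim] and p = vs1.ref_projection[OF sub(1)]
  note b = vs2.ref_frame[OF sub(2), unfolded dim] and q = vs2.ref_projection[OF sub(2)]
  define x where "x i = g' (vs2.ref_frame B i)" for i
  define y where "y i = f' (vs1.ref_frame A i)" for i
  have zero: "\<forall>i\<ge>r. x i = 0" "\<forall>i\<ge>r. y i = 0"
    using a(1) b(1) linear_0[OF f'] flip.linear_0[OF g']
    by (simp_all add: x_def y_def vs1.frame_def vs2.frame_def)
  have spanx: "vs1.span (range x) = A"
    using flip.image_span_range[OF g', of "vs2.ref_frame B" x] by (simp add: x_def b(2) g'B)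
  have spany: "vs2.span (range y) = B"
    using image_span_range[OF f', of "vs1.ref_frame A" y] by (simp add: y_def a(2) f'A)
  have x: "vs1.frame r x"
    by (rule vs1.frame_if_dim_span[OF zero(1)]) (simp only: spanx dim)
  have y: "vs2.frame r y"
    by (rule vs2.frame_if_dim_span[OF zero(2)]) (simp only: spany dim)
  have zero': "\<forall>i\<ge>r. x (Suc i) = 0"
    using zero by simp
  obtain f where f: "Vector_Spaces.linear s1 s2 f" "redirects x (vs1.ref_projection A) y f' f"
    using redirects_exists[OF x zero(2) _ f'] p spanx by metis
  obtain g where g: "Vector_Spaces.linear s2 s1 g"
      "redirects y (vs2.ref_projection B) (\<lambda>i. x (Suc i)) g' g"
    using flip.redirects_exists[OF y zero' _ g'] q spany by metis
  have fx: "f (x i) = y i" and gy: "g (y i) = x (Suc i)" for i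
    using f(2) g(2) by (simp_all add: redirects_def)
  have orb: "orbit f g (x 0) = x"
  proof
    show "orbit f g (x 0) i = x i" for i
      by (induction i) (simp_all add: orbit_step[symmetric] fx gy)
  qed
  have fA: "f ` A = B"
    using image_span_range[OF f(1), of x y] fx by (simp add: spanx spany)
  have gB: "g ` B \<subseteq> A"
  proof -
    have "g ` B = vs1.span (range (\<lambda>i. x (Suc i)))"
      using flip.image_span_range[OF g(1), of y "\<lambda>i. x (Suc i)"] gy by (simp add: spany)
    also have "\<dots> \<subseteq> vs1.span (range x)"
      by (rule vs1.span_mono) blast
    finally show ?thesis by (simp add: spanx)
  qed
  let ?T = "g \<circ> f"
  have T: "Vector_Spaces.linear s1 s1 ?T"
    by (rule Vector_Spaces.linear_compose[OF f(1) g(1)])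
  have "nilpotent_map ?T"
  proof -
    obtain n where n: "\<And>z. ((g' \<circ> f') ^^ n) z \<in> A"
      using core by (auto simp: core_pair_def)
    have "f' z - f z \<in> B" for z
      using redirects_congruent[OF f' f(1) p sub(2) _ _ f(2)] fA f'A by blast
    moreover have "g' z - g z \<in> A" for z
      using flip.redirects_congruent[OF g' g(1) q sub(1) _ _ g(2)] gB g'B by blast
    ultimately have "((g' \<circ> f') ^^ n) z \<in> A \<longleftrightarrow> (?T ^^ n) z \<in> A" for z
      by (rule congruent_funpow[OF f' g' sub(1) eq_refl[OF f'A] eq_refl[OF g'B]])
    then have TA: "(?T ^^ n) z \<in> A" for z
      using n by simp
    have "(?T ^^ r) z = 0" if "z \<in> A" for z
    proof -
      have "(?T ^^ r) (x i) = 0" for i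
      proof -
        have "(?T ^^ r) (x i) = (?T ^^ (r + i)) (x 0)"
          using fun_cong[OF orb, of i] by (simp add: orbit_def funpow_add)
        also have "\<dots> = x (r + i)"
          using fun_cong[OF orb, of "r + i"] by (simp only: orbit_def)
        finally show ?thesis using zero by simp
      qed
      then show ?thesis
        using vv.linear_eq_on[OF vs1.linear_funpow[OF T] vv.linear_zero, of z "range x" r] that
        by (auto simp: spanx)
    qed
    then have "(?T ^^ (r + n)) z = 0" for z
      using TA by (simp add: funpow_add)
    then show ?thesis
      unfolding nilpotent_map_def by blast
  qed
  moreover have "balanced f g (x 0)"
    using balanced_iff_frames[OF f(1) g(1) \<open>nilpotent_map ?T\<close>, of "x 0"] x y
    by (auto simp: orb fx)
  ultimately have "balanced_triple f g (x 0)"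
    using f(1) g(1) by (simp add: balanced_triple_def)
  moreover have "exchange f g (x 0) f' g'"
    using f(2) g(2)
    by (simp add: exchange_def Let_def orb fx spanx spany redirects_def) (simp add: x_def y_def)
  ultimately show thesis ..
qed

end

lemma bij_betw_of_relation:
  assumes total: "\<And>x. x \<in> X \<Longrightarrow> \<exists>y\<in>Y. R x y" and surj: "\<And>y. y \<in> Y \<Longrightarrow> \<exists>x\<in>X. R x y"
    and functional: "\<And>x y y'. \<lbrakk>x \<in> X; y \<in> Y; y' \<in> Y; R x y; R x y'\<rbrakk> \<Longrightarrow> y = y'"
    and inj: "\<And>x x' y. \<lbrakk>x \<in> X; x' \<in> X; y \<in> Y; R x y; R x' y\<rbrakk> \<Longrightarrow> x = x'"
  shows "\<exists>h. bij_betw h X Y"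
proof -
  obtain h where h: "\<And>x. x \<in> X \<Longrightarrow> h x \<in> Y \<and> R x (h x)"
    using total by metis
  have "inj_on h X"
    using h inj by (metis inj_onI)
  moreover have "h ` X = Y"
  proof
    show "Y \<subseteq> h ` X"
      using h surj functional by (metis image_eqI subsetI)
  qed (use h in blast)
  ultimately show ?thesis
    unfolding bij_betw_def by blast
qed

theorem theorem4p6:
  fixes scaleV :: "'k::field \<Rightarrow> 'v::ab_group_add \<Rightarrow> 'v"
    and scaleW :: "'k \<Rightarrow> 'w::ab_group_add \<Rightarrow> 'w"
  assumes "finite_dimensional_vector_space scaleV BasisV"
    and "finite_dimensional_vector_space scaleW BasisW"
  shows "\<exists>h. bij_betw h
    {(f, g, v). Vector_Spaces.linear scaleV scaleW f \<and> Vector_Spaces.linear scaleW scaleV g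
      \<and> nilpotent_map (g \<circ> f) \<and> balanced f g v}
    ({f. Vector_Spaces.linear scaleV scaleW f} \<times> {g. Vector_Spaces.linear scaleW scaleV g})"
proof -
  interpret finite_dimensional_vector_space_pair scaleV BasisV scaleW BasisW
    using assms by (rule finite_dimensional_vector_space_pair.intro)
  let ?R = "\<lambda>(f, g, v) (f', g'). exchange f g v f' g'"
  show ?thesis
    unfolding balanced_triple_def[symmetric]
  proof (rule bij_betw_of_relation[where R = ?R], goal_cases)
    case (1 t)
    then show ?case using exchange_exists by (auto simp: Bex_def) blast
  next
    case (2 s)
    then show ?case using exchange_surjective by (auto simp: Bex_def) blast
  next
    case (3 t s s')
    then show ?case using exchange_functional by auto
  next
    case (4 t t' s)
    then show ?case using exchange_injective by auto
  qed
qed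

end
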